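(* Let $I\subset\mathbb R$ be an interval, $t_0\in I$, and let $(\gamma_h,\gamma_h^d):I\to\Delta_1$ be a spacelike Legendre curve with curvature $(m_h,n_h)$ and $\gamma_h^s=\gamma_h\wedge\gamma_h^d$. Put $a(t)=\int_{t_0}^tm_h(\tau)\,d\tau$ and let $HI_{t_0}=\cosh a\,\gamma_h-\sinh a\,\gamma_h^s$ and $DI_{t_0}=\sinh a\,\gamma_h-\cosh a\,\gamma_h^s$ be the hyperbolic and de Sitter involutes of $(\gamma_h,\gamma_h^d)$, and let $\mu_I=HI_{t_0}\wedge DI_{t_0}$. Then, at every $t\in I$, $$(HI_{t_0},DI_{t_0},\mu_I)^T=B_1(a)\,R(\pi/2)\,(\gamma_h,\gamma_h^d,\gamma_h^s)^T .$$
   Context: All maps are $C^\infty$. $\mathbb R^3_1$ is $\mathbb R^3$ with $\langle x,y\rangle=-x_1y_1+x_2y_2+x_3y_3$ and $x\wedge y=(-(x_2y_3-x_3y_2),\,x_3y_1-x_1y_3,\,x_1y_2-x_2y_1)$. $H^2=\{x:\langle x,x\rangle=-1\}$, $S^2_1=\{x:\langle x,x\rangle=1\}$, $\Delta_1=\{(v,w)\in H^2\times S_1^2:\langle v,w\rangle=0\}$. A spacelike Legendre curve in $\Delta_1$ is a smooth map $(\gamma_h,\gamma_h^d):I\to\Delta_1$ with $\langle\dot\gamma_h,\gamma_h^d\rangle=0$ on $I$. Its curvature $(m_h,n_h)$ is defined by $\dot\gamma_h=m_h\gamma_h^s$, $\dot\gamma_h^d=n_h\gamma_h^s$, $\dot\gamma_h^s=m_h\gamma_h-n_h\gamma_h^d$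 with $\gamma_h^s=\gamma_h\wedge\gamma_h^d$. Matrices: $R(\phi)=\begin{pmatrix}1&0&0\\0&\cos\phi&-\sin\phi\\0&\sin\phi&\cos\phi\end{pmatrix}$, $B_1(\phi)=\begin{pmatrix}\cosh\phi&\sinh\phi&0\\ \sinh\phi&\cosh\phi&0\\0&0&1\end{pmatrix}$. For a $3\times3$ matrix $A=(a_{ij})$ and vectors $v_1,v_2,v_3$, $A(v_1,v_2,v_3)^T$ denotes the triple whose $i$-th entry is $\sum_j a_{ij}v_j$. *)

theory Defs
  imports "HOL-Analysis.Analysis"
begin

definition lorentz :: "real^3 \<Rightarrow> real^3 \<Rightarrow> real" where
  "lorentz x y = - (x$1 * y$1) + x$2 * y$2 + x$3 * y$3"

definition wedge :: "real^3 \<Rightarrow> real^3 \<Rightarrow> real^3" where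
  "wedge x y = vector [- (x$2 * y$3 - x$3 * y$2), x$3 * y$1 - x$1 * y$3, x$1 * y$2 - x$2 * y$1]"

definition H2 :: "(real^3) set" where
  "H2 = {x. lorentz x x = -1}"

definition S21 :: "(real^3) set" where
  "S21 = {x. lorentz x x = 1}"

definition Delta1 :: "((real^3) \<times> (real^3)) set" where
  "Delta1 = {(v, w). v \<in> H2 \<and> w \<in> S21 \<and> lorentz v w = 0}"

text \<open>
  \<open>F k\<close> is the \<open>k\<close>-th derivative of \<open>f\<close> on \<open>I\<close>. Derivatives are taken within \<open>I\<close>, hence are
  one-sided at those endpoints of the interval that belong to it.
\<close>
definition smooth_on :: "real set \<Rightarrow> (real \<Rightarrow> 'a::real_normed_vector) \<Rightarrow> bool" where
  "smooth_on I f \<longleftrightarrow>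
     (\<exists>F :: nat \<Rightarrow> real \<Rightarrow> 'a.
        (\<forall>t\<in>I. F 0 t = f t) \<and>
        (\<forall>k. \<forall>t\<in>I. (F k has_vector_derivative F (Suc k) t) (at t within I)))"

definition spacelike_legendre_curve :: "real set \<Rightarrow> (real \<Rightarrow> real^3) \<Rightarrow> (real \<Rightarrow> real^3) \<Rightarrow> bool" where
  "spacelike_legendre_curve I \<gamma> \<gamma>d \<longleftrightarrow>
     smooth_on I (\<lambda>t. (\<gamma> t, \<gamma>d t)) \<and>
     (\<forall>t\<in>I. (\<gamma> t, \<gamma>d t) \<in> Delta1) \<and>
     (\<forall>t\<in>I. lorentz (vector_derivative \<gamma> (at t within I)) (\<gamma>d t) = 0)"

definition gamma_s :: "(real \<Rightarrow> real^3) \<Rightarrow> (real \<Rightarrow> real^3) \<Rightarrow> real \<Rightarrow> real^3" where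
  "gamma_s \<gamma> \<gamma>d t = wedge (\<gamma> t) (\<gamma>d t)"

text \<open>
  On a nondegenerate interval \<open>I\<close> these equations determine \<open>m\<close> and \<open>n\<close> on \<open>I\<close>: since \<open>\<gamma>s\<close> is a
  unit spacelike vector, \<open>m\<close> and \<open>n\<close> are the products of \<open>\<gamma>s\<close> with the derivatives of
  \<open>\<gamma>\<close> and \<open>\<gamma>d\<close>. In particular they are smooth, which is therefore not required separately.
\<close>
definition legendre_curvature ::
  "real set \<Rightarrow> (real \<Rightarrow> real^3) \<Rightarrow> (real \<Rightarrow> real^3) \<Rightarrow> (real \<Rightarrow> real) \<Rightarrow> (real \<Rightarrow> real) \<Rightarrow> bool" where
  "legendre_curvature I \<gamma> \<gamma>d m n \<longleftrightarrow>
     (\<forall>t\<in>I.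
        (\<gamma> has_vector_derivative m t *\<^sub>R gamma_s \<gamma> \<gamma>d t) (at t within I) \<and>
        (\<gamma>d has_vector_derivative n t *\<^sub>R gamma_s \<gamma> \<gamma>d t) (at t within I) \<and>
        (gamma_s \<gamma> \<gamma>d has_vector_derivative m t *\<^sub>R \<gamma> t - n t *\<^sub>R \<gamma>d t) (at t within I))"

text \<open>The interval integral is oriented, so \<open>t < t0\<close> is covered.\<close>
definition angle_from :: "real \<Rightarrow> (real \<Rightarrow> real) \<Rightarrow> real \<Rightarrow> real" where
  "angle_from t0 m t = (LBINT \<tau>=ereal t0..ereal t. m \<tau>)"

definition hyperbolic_involute ::
  "real \<Rightarrow> (real \<Rightarrow> real) \<Rightarrow> (real \<Rightarrow> real^3) \<Rightarrow> (real \<Rightarrow> real^3) \<Rightarrow> real \<Rightarrow> real^3" where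
  "hyperbolic_involute t0 m \<gamma> \<gamma>d t =
     cosh (angle_from t0 m t) *\<^sub>R \<gamma> t - sinh (angle_from t0 m t) *\<^sub>R gamma_s \<gamma> \<gamma>d t"

definition de_sitter_involute ::
  "real \<Rightarrow> (real \<Rightarrow> real) \<Rightarrow> (real \<Rightarrow> real^3) \<Rightarrow> (real \<Rightarrow> real^3) \<Rightarrow> real \<Rightarrow> real^3" where
  "de_sitter_involute t0 m \<gamma> \<gamma>d t =
     sinh (angle_from t0 m t) *\<^sub>R \<gamma> t - cosh (angle_from t0 m t) *\<^sub>R gamma_s \<gamma> \<gamma>d t"

definition rot_R :: "real \<Rightarrow> real^3^3" where
  "rot_R \<phi> = vector [vector [1, 0, 0],
                     vector [0, cos \<phi>, - sin \<phi>],
                     vector [0, sin \<phi>, cos \<phi>]]"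

definition boost_B1 :: "real \<Rightarrow> real^3^3" where
  "boost_B1 \<phi> = vector [vector [cosh \<phi>, sinh \<phi>, 0],
                        vector [sinh \<phi>, cosh \<phi>, 0],
                        vector [0, 0, 1]]"

text \<open>A triple of vectors is an element of \<open>(real^3)^3\<close>, i.e. its \<open>j\<close>-th component is the vector \<open>v\<^sub>j\<close>.\<close>
definition act_triple :: "real^3^3 \<Rightarrow> (real^3)^3 \<Rightarrow> (real^3)^3" where
  "act_triple A v = (\<chi> i. \<Sum>j\<in>UNIV. (A $ i $ j) *\<^sub>R (v $ j))"

end

theory Submission
  imports Defs
begin

text \<open>
  The statement is linear algebra at each single parameter value. The quarter turn
  \<open>R(\<pi>/2)\<close> sends the triple \<open>(\<gamma>, \<gamma>d, \<gamma>s)\<close> to \<open>(\<gamma>, -\<gamma>s, \<gamma>d)\<close>, and the boost \<open>B\<^sub>1\<close> mixes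
  the first two entries, which reproduces the two involutes and leaves \<open>\<gamma>d\<close> in the last place.
  So the only claim with content is that \<open>\<mu> = \<gamma>d\<close>. The involutes arise from \<open>\<gamma>\<close> and \<open>\<gamma>s\<close>
  by a linear map of the plane with determinant \<open>sinh\<^sup>2 - cosh\<^sup>2 = -1\<close>, hence \<open>\<mu>\<close> is
  \<open>- (\<gamma> \<and> \<gamma>s) = - (\<gamma> \<and> (\<gamma> \<and> \<gamma>d))\<close>. The Lorentzian triple product expansion, together with
  \<open>\<langle>\<gamma>, \<gamma>\<rangle> = -1\<close> and \<open>\<langle>\<gamma>, \<gamma>d\<rangle> = 0\<close>, turns this into \<open>\<gamma>d\<close>.
\<close>

text \<open>
  The expansion has the opposite sign to the Euclidean one because the metric has determinant \<open>-1\<close>.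
\<close>
lemma wedge_triple_product:
  "wedge x (wedge y z) = lorentz x y *\<^sub>R z - lorentz x z *\<^sub>R y"
  by (simp add: vec_eq_iff forall_3 wedge_def lorentz_def algebra_simps)

text \<open>
  An alternating bilinear product depends on a basis of a plane only through the determinant; the
  minus sign is there because the boost acts on \<open>(x, - y)\<close>.
\<close>
lemma wedge_boosted_pair:
  "wedge (cosh \<phi> *\<^sub>R x - sinh \<phi> *\<^sub>R y) (sinh \<phi> *\<^sub>R x - cosh \<phi> *\<^sub>R y) = - wedge x y"
proof -
  have bilinear: "wedge (c *\<^sub>R x - s *\<^sub>R y) (s *\<^sub>R x - c *\<^sub>R y) = - (c\<^sup>2 - s\<^sup>2) *\<^sub>R wedge x y"
    for c s :: real
    by (simp add: vec_eq_iff forall_3 wedge_def algebra_simps power2_eq_square)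
  show ?thesis
    by (simp only: bilinear hyperbolic_pythagoras) simp
qed

lemma wedge_wedge_Delta1:
  assumes "(v, w) \<in> Delta1"
  shows "wedge v (wedge v w) = - w"
  using assms by (simp add: wedge_triple_product Delta1_def H2_def)

lemma boost_B1_quarter_turn:
  "boost_B1 \<phi> ** rot_R (pi / 2) =
     vector [vector [cosh \<phi>, 0, - sinh \<phi>], vector [sinh \<phi>, 0, - cosh \<phi>], vector [0, 1, 0]]"
  by (simp add: vec_eq_iff forall_3 matrix_matrix_mult_def sum_3 boost_B1_def rot_R_def)

theorem proposition3p20:
  fixes I :: "real set" and t0 :: real
    and \<gamma> \<gamma>d HI DI \<mu> :: "real \<Rightarrow> real^3"
    and m n a :: "real \<Rightarrow> real"
  assumes "is_interval I" and "t0 \<in> I"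
    and "spacelike_legendre_curve I \<gamma> \<gamma>d"
    and "legendre_curvature I \<gamma> \<gamma>d m n"
  defines "a \<equiv> angle_from t0 m"
    and "HI \<equiv> hyperbolic_involute t0 m \<gamma> \<gamma>d"
    and "DI \<equiv> de_sitter_involute t0 m \<gamma> \<gamma>d"
    and "\<mu> \<equiv> \<lambda>t. wedge (HI t) (DI t)"
  shows "\<forall>t\<in>I. (vector [HI t, DI t, \<mu> t] :: (real^3)^3) =
           act_triple (boost_B1 (a t) ** rot_R (pi / 2))
             (vector [\<gamma> t, \<gamma>d t, gamma_s \<gamma> \<gamma>d t])"
proof
  fix t assume "t \<in> I"
  have HI: "HI t = cosh (a t) *\<^sub>R \<gamma> t - sinh (a t) *\<^sub>R gamma_s \<gamma> \<gamma>d t"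
    and DI: "DI t = sinh (a t) *\<^sub>R \<gamma> t - cosh (a t) *\<^sub>R gamma_s \<gamma> \<gamma>d t"
    by (simp_all add: HI_def DI_def a_def hyperbolic_involute_def de_sitter_involute_def)
  have "(\<gamma> t, \<gamma>d t) \<in> Delta1"
    using assms(3) \<open>t \<in> I\<close> by (simp add: spacelike_legendre_curve_def)
  then have "\<mu> t = \<gamma>d t"
    by (simp add: \<mu>_def HI DI wedge_boosted_pair gamma_s_def wedge_wedge_Delta1)
  then show "(vector [HI t, DI t, \<mu> t] :: (real^3)^3) =
      act_triple (boost_B1 (a t) ** rot_R (pi / 2)) (vector [\<gamma> t, \<gamma>d t, gamma_s \<gamma> \<gamma>d t])"
    by (simp add: boost_B1_quarter_turn act_triple_def HI DI vec_eq_iff[where 'b = 3]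
        forall_3 sum_3)
qed

end
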